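(* Let $p$ be a prime number such that $g=p+1$ is an even integer with $g\ge4$. Then there is no primitive number $m\neq g-1$ with $o_g(m)<g$.
   Context: For an odd integer $m\ge1$, an extreme cycle for the digit set $\{0,m\}$ (with respect to the even integer $g\ge 4$) is a finite set of distinct integers $\{x_0,\dots,x_{r-1}\}$ together with digits $l_0,\dots,l_{r-1}\in\{0,m\}$ such that $x_{j+1}=(x_j+l_j)/g$ for $0\le j\le r-2$ and $x_0=(x_{r-1}+l_{r-1})/g$. The cycle $\{0\}$ is the trivial extreme cycle. The odd number $m$ is complete if the only extreme cycle for $\{0,m\}$ is the trivial one, and incomplete otherwise. An odd number $m$ is primitive if it is incomplete and every proper divisor of $m$ is complete; it is a non-trivial primitive number if moreover $m\neq g-1$. Primitive numbers are coprime to $g$, and $o_g(m)$ denotes the order of $g$ in $U(\mathbb{Z}_m)$. *)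

theory Defs
  imports "HOL-Number_Theory.Number_Theory"
begin

(* A cycle of length r is indexed by 0, ..., r - 1; the values of x and l at other indices are
   irrelevant. Reducing the successor index modulo r closes the cycle. The division is exact
   division: both sides are compared in the rationals, so x j + l j must be divisible by g. *)
definition extreme_cycle :: "nat \<Rightarrow> nat \<Rightarrow> nat \<Rightarrow> (nat \<Rightarrow> int) \<Rightarrow> (nat \<Rightarrow> int) \<Rightarrow> bool" where
  "extreme_cycle g m r x l \<longleftrightarrow>
     r \<ge> 1 \<and> inj_on x {..<r} \<and> (\<forall>j<r. l j \<in> {0, int m}) \<and>
     (\<forall>j<r. rat_of_int (x (Suc j mod r)) = rat_of_int (x j + l j) / rat_of_nat g)"

definition complete_number :: "nat \<Rightarrow> nat \<Rightarrow> bool" where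
  "complete_number g m \<longleftrightarrow>
     odd m \<and> (\<forall>r x l. extreme_cycle g m r x l \<longrightarrow> x ` {..<r} = {0})"

definition incomplete_number :: "nat \<Rightarrow> nat \<Rightarrow> bool" where
  "incomplete_number g m \<longleftrightarrow> odd m \<and> \<not> complete_number g m"

definition primitive_number :: "nat \<Rightarrow> nat \<Rightarrow> bool" where
  "primitive_number g m \<longleftrightarrow>
     incomplete_number g m \<and> (\<forall>d. d dvd m \<and> d \<noteq> m \<longrightarrow> complete_number g d)"

end

theory Submission
  imports Defs
begin

text \<open>
  Summing the relations \<open>g x\<^sub>j\<^sub>+\<^sub>1 = x\<^sub>j + l\<^sub>j\<close> over a cycle of length \<open>r\<close> gives
  \<open>(g - 1) \<Sum>x\<^sub>j = m k\<close>, where \<open>k \<le> r\<close> is the number of digits equal to \<open>m\<close>. The prime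
  \<open>p = g - 1\<close> is itself incomplete, so it does not divide a primitive \<open>m \<noteq> p\<close>, and hence
  \<open>p dvd k\<close>. Moreover \<open>r\<close> divides the order of \<open>g\<close> modulo \<open>m\<close>, which is at most \<open>p\<close>.
  Therefore \<open>k = 0\<close>, and the cycle is trivial, or \<open>k = r = p\<close>, and all points of the cycle
  equal \<open>m / p\<close>, which contradicts \<open>\<not> p dvd m\<close>.
\<close>

text \<open>Clearing the denominator turns exact division into an integer equation, the form needed
  by the arguments on size, sums, congruences and divisibility.\<close>

lemma extreme_cycle_step:
  assumes "extreme_cycle g m r x l" "g > 0" "j < r"
  shows "int g * x (Suc j mod r) = x j + l j"
proof -
  have "rat_of_int (x (Suc j mod r)) = rat_of_int (x j + l j) / rat_of_nat g"
    using assms unfolding extreme_cycle_def by blast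
  then have "rat_of_int (int g * x (Suc j mod r)) = rat_of_int (x j + l j)"
    using \<open>g > 0\<close> by (simp add: field_simps)
  then show ?thesis by (simp only: of_int_eq_iff)
qed

lemma extreme_cycleI:
  assumes "r \<ge> 1" "inj_on x {..<r}" "g > 0"
    and "\<And>j. j < r \<Longrightarrow> l j \<in> {0, int m}"
    and "\<And>j. j < r \<Longrightarrow> int g * x (Suc j mod r) = x j + l j"
  shows "extreme_cycle g m r x l"
proof -
  have "rat_of_int (x (Suc j mod r)) = rat_of_int (x j + l j) / rat_of_nat g" if "j < r" for j
  proof -
    have "rat_of_int (int g * x (Suc j mod r)) = rat_of_int (x j + l j)"
      using assms(5)[OF that] by simp
    then show ?thesis using \<open>g > 0\<close> by (simp add: field_simps)
  qed
  then show ?thesis using assms unfolding extreme_cycle_def by blast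
qed

text \<open>An injective self-map of a finite set is onto. This supplies predecessors on the cycle
  and allows reindexing of sums over it.\<close>

lemma bij_betw_Suc_mod:
  assumes "r \<ge> 1"
  shows "bij_betw (\<lambda>j. Suc j mod r) {..<r} {..<r}"
proof -
  have "inj_on (\<lambda>j. Suc j mod r) {..<r}"
    by (auto simp: inj_on_def mod_Suc split: if_splits)
  moreover have "(\<lambda>j. Suc j mod r) ` {..<r} \<subseteq> {..<r}"
    using assms by auto
  ultimately show ?thesis
    by (simp add: bij_betw_def endo_inj_surj)
qed

text \<open>Look at the predecessors of a minimal point \<open>x a\<close> and a maximal point
  \<open>x b\<close>: since digits lie between 0 and \<open>m\<close>,
  \<open>g * x a \<ge> x a\<close> and \<open>g * x b \<le> x b + m\<close>.\<close>

lemma extreme_cycle_bounds: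
  assumes cyc: "extreme_cycle g m r x l" and g: "g \<ge> 2" and j: "j < r"
  shows "0 \<le> x j" and "(int g - 1) * x j \<le> int m"
proof -
  have r: "r \<ge> 1" and l: "\<And>i. i < r \<Longrightarrow> 0 \<le> l i \<and> l i \<le> int m"
    using cyc by (auto simp: extreme_cycle_def)
  have ne: "x ` {..<r} \<noteq> {}" using j by auto
  have pred: "\<exists>i<r. int g * x k = x i + l i" if "k < r" for k
  proof -
    have "k \<in> (\<lambda>i. Suc i mod r) ` {..<r}"
      using bij_betw_imp_surj_on[OF bij_betw_Suc_mod[OF r]] that by simp
    then obtain i where "i < r" "Suc i mod r = k" by auto
    then show ?thesis using extreme_cycle_step[OF cyc _ \<open>i < r\<close>] g by auto
  qed
  have "Min (x ` {..<r}) \<in> x ` {..<r}" using ne by (intro Min_in) auto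
  then obtain a where a: "a < r" "x a = Min (x ` {..<r})" by auto
  have amin: "x a \<le> x i" if "i < r" for i using a that by simp
  have "Max (x ` {..<r}) \<in> x ` {..<r}" using ne by (intro Max_in) auto
  then obtain b where b: "b < r" "x b = Max (x ` {..<r})" by auto
  have bmax: "x i \<le> x b" if "i < r" for i using b that by simp
  obtain i where i: "i < r" "int g * x a = x i + l i" using pred[OF a(1)] by blast
  have "(int g - 1) * x a \<ge> 0"
    using i amin[OF i(1)] l[OF i(1)] by (simp add: algebra_simps)
  then have "0 \<le> x a" using g by (simp add: zero_le_mult_iff)
  then show "0 \<le> x j" using amin[OF j] by simp
  obtain k where k: "k < r" "int g * x b = x k + l k" using pred[OF b(1)] by blast
  have "(int g - 1) * x b \<le> int m"
    using k bmax[OF k(1)] l[OF k(1)] by (simp add: algebra_simps)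
  moreover have "(int g - 1) * x j \<le> (int g - 1) * x b"
    using bmax[OF j] g by (intro mult_left_mono) auto
  ultimately show "(int g - 1) * x j \<le> int m" by simp
qed

lemma extreme_cycle_sum:
  assumes cyc: "extreme_cycle g m r x l" and g: "g > 0"
  shows "(int g - 1) * (\<Sum>j<r. x j) = (\<Sum>j<r. l j)"
proof -
  have r: "r \<ge> 1" using cyc by (simp add: extreme_cycle_def)
  have "int g * (\<Sum>j<r. x j) = int g * (\<Sum>j<r. x (Suc j mod r))"
    using sum.reindex_bij_betw[OF bij_betw_Suc_mod[OF r], of x] by simp
  also have "\<dots> = (\<Sum>j<r. x j) + (\<Sum>j<r. l j)"
    unfolding sum_distrib_left sum.distrib[symmetric]
    by (intro sum.cong) (auto simp: extreme_cycle_step[OF cyc g])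
  finally show ?thesis by (simp add: algebra_simps)
qed

text \<open>Digits vanish modulo \<open>m\<close>, so one step along the cycle is undone by
  multiplying by \<open>g\<close>, and \<open>k\<close> steps by \<open>g ^ k\<close>.\<close>

lemma extreme_cycle_cong_power:
  assumes cyc: "extreme_cycle g m r x l" and g: "g > 0"
  shows "[int g ^ k * x (k mod r) = x 0] (mod int m)"
proof (induction k)
  case 0
  show ?case by simp
next
  case (Suc k)
  have kr: "k mod r < r" using cyc by (simp add: extreme_cycle_def)
  have "int g * x (Suc k mod r) = x (k mod r) + l (k mod r)"
    using extreme_cycle_step[OF cyc g kr] by (simp add: mod_Suc_eq)
  moreover have "[l (k mod r) = 0] (mod int m)"
    using cyc kr by (auto simp: extreme_cycle_def cong_0_iff)
  ultimately have "[int g * x (Suc k mod r) = x (k mod r)] (mod int m)"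
    by (metis add.right_neutral cong_add_lcancel)
  then have "[int g ^ k * (int g * x (Suc k mod r)) = int g ^ k * x (k mod r)] (mod int m)"
    by (rule cong_scalar_left)
  then show ?case
    using Suc.IH by (metis cong_trans mult.assoc power_Suc2)
qed

text \<open>After \<open>ord m g\<close> steps the cycle is back in the residue class of
  \<open>x 0\<close>. All points lie in \<open>[0, m)\<close>, so it is back at \<open>x 0\<close>
  itself, and the points being distinct, a whole number of turns was made.\<close>

lemma extreme_cycle_length_dvd_ord:
  assumes cyc: "extreme_cycle g m r x l" and g: "g \<ge> 3" and m: "m > 0"
    and copr: "coprime m g"
  shows "r dvd ord m g"
proof -
  have r: "r \<ge> 1" and inj: "inj_on x {..<r}" using cyc by (auto simp: extreme_cycle_def)
  let ?k = "ord m g mod r"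
  have kr: "?k < r" using r by simp
  have lt: "0 \<le> x i \<and> x i < int m" if "i < r" for i
  proof -
    have "0 \<le> x i" "(int g - 1) * x i \<le> int m"
      using extreme_cycle_bounds[OF cyc _ that] g by auto
    \<comment> \<open>The factor 2 makes the upper bound strict: \<open>x i \<le> m / 2 < m\<close>.
      For \<open>g = 2\<close> the congruent points 0 and \<open>m\<close> could not be told
      apart.\<close>
    moreover have "2 * x i \<le> (int g - 1) * x i"
      using \<open>0 \<le> x i\<close> g by (intro mult_right_mono) auto
    ultimately show ?thesis using m by linarith
  qed
  have "[int (g ^ ord m g) = int 1] (mod int m)"
    using ord_works[of g m] by (simp only: cong_int_iff)
  then have "[int g ^ ord m g = 1] (mod int m)" by simp
  then have "[int g ^ ord m g * x ?k = 1 * x ?k] (mod int m)"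
    by (rule cong_scalar_right)
  then have "[x ?k = x 0] (mod int m)"
    using extreme_cycle_cong_power[OF cyc, of "ord m g"] g
    by (metis cong_sym cong_trans gr0I mult_1 not_numeral_le_zero)
  then have "x ?k = x 0"
    using lt[OF kr] lt[of 0] r cong_less_imp_eq_int by auto
  then have "?k = 0" using inj kr r by (auto dest: inj_onD)
  then show ?thesis by auto
qed

lemma extreme_cycle_divide:
  assumes cyc: "extreme_cycle g (q * m) r (\<lambda>j. int q * x j) (\<lambda>j. int q * l j)"
    and q: "q > 0" and g: "g > 0"
  shows "extreme_cycle g m r x l"
proof (rule extreme_cycleI[OF _ _ g])
  show "r \<ge> 1" using cyc by (simp add: extreme_cycle_def)
  show "inj_on x {..<r}" using cyc q by (auto simp: extreme_cycle_def inj_on_def)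
  show "l j \<in> {0, int m}" if "j < r" for j
  proof -
    have "int q * l j \<in> {0, int (q * m)}" using cyc that by (auto simp: extreme_cycle_def)
    then show ?thesis using q by auto
  qed
  show "int g * x (Suc j mod r) = x j + l j" if "j < r" for j
  proof -
    have "int q * (int g * x (Suc j mod r)) = int q * (x j + l j)"
      using extreme_cycle_step[OF cyc g that] by (simp add: algebra_simps)
    then show ?thesis using q by simp
  qed
qed

lemma incomplete_obtain_cycle:
  assumes "incomplete_number g m"
  obtains r x l j where "extreme_cycle g m r x l" "j < r" "x j \<noteq> 0"
proof -
  obtain r x l where cyc: "extreme_cycle g m r x l" and nt: "x ` {..<r} \<noteq> {0}"
    using assms unfolding incomplete_number_def complete_number_def by blast
  \<comment> \<open>The image could also differ from \<open>{0}\<close> by being empty; this rules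
    that out.\<close>
  have "{..<r} \<noteq> {}" using cyc by (auto simp: extreme_cycle_def lessThan_empty_iff)
  have "\<exists>j<r. x j \<noteq> 0"
  proof (rule ccontr)
    assume "\<not> (\<exists>j<r. x j \<noteq> 0)"
    then have "x ` {..<r} = (\<lambda>_. 0) ` {..<r}" by (intro image_cong) auto
    also have "\<dots> = {0}" using \<open>{..<r} \<noteq> {}\<close> by (simp only: image_constant_conv if_False)
    finally show False using nt by contradiction
  qed
  then show thesis using that[OF cyc] by blast
qed

lemma complete_cycle_trivial:
  assumes "complete_number g m" "extreme_cycle g m r x l" "j < r"
  shows "x j = 0"
  using assms unfolding complete_number_def by blast

text \<open>A common prime factor \<open>q\<close> of \<open>m\<close> and \<open>g\<close> divides
  every digit, hence by the cycle relation every point. Dividing by \<open>q\<close> leaves a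
  nontrivial cycle for the proper divisor \<open>m / q\<close>, which is complete.\<close>

lemma primitive_number_coprime:
  assumes prim: "primitive_number g m" and g: "g > 0"
  shows "coprime m g"
proof (rule ccontr)
  assume "\<not> coprime m g"
  then obtain q where q: "prime q" "q dvd m" "q dvd g"
    by (metis coprime_iff_gcd_eq_1 dvd_trans gcd_dvd1 gcd_dvd2 prime_factor_nat)
  have inc: "incomplete_number g m" using prim by (simp add: primitive_number_def)
  obtain r x l i where cyc: "extreme_cycle g m r x l" and i: "i < r" "x i \<noteq> 0"
    by (rule incomplete_obtain_cycle[OF inc])
  obtain d where d: "m = q * d" using q by blast
  have r: "r \<ge> 1" using cyc by (simp add: extreme_cycle_def)
  have "m > 0" using inc by (auto simp: incomplete_number_def intro: odd_pos)
  then have "d \<noteq> m" using d prime_gt_1_nat[OF q(1)] by auto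
  then have comp: "complete_number g d" using prim d by (auto simp: primitive_number_def)
  have ldvd: "int q dvd l j" if "j < r" for j
    using cyc that d by (auto simp: extreme_cycle_def)
  have xdvd: "int q dvd x j" if "j < r" for j
  proof -
    have "int q dvd int g * x (Suc j mod r)" using q(3) by simp
    then show ?thesis
      using extreme_cycle_step[OF cyc g that] ldvd[OF that] by (simp add: dvd_add_left_iff)
  qed
  \<comment> \<open>Divisibility by \<open>q\<close> is known only at indices below
    \<open>r\<close>, so the functions need not be equal; the predicate is unfolded because it
    inspects only those indices.\<close>
  have "extreme_cycle g m r (\<lambda>j. int q * (x j div int q)) (\<lambda>j. int q * (l j div int q))
    \<longleftrightarrow> extreme_cycle g m r x l"
    unfolding extreme_cycle_def
    using r xdvd ldvd by (auto simp: inj_on_def)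
  then have "extreme_cycle g (q * d) r
      (\<lambda>j. int q * (x j div int q)) (\<lambda>j. int q * (l j div int q))"
    using cyc d by blast
  then have "extreme_cycle g d r (\<lambda>j. x j div int q) (\<lambda>j. l j div int q)"
    by (rule extreme_cycle_divide[OF _ prime_gt_0_nat[OF q(1)] g])
  then have "x i div int q = 0"
    using complete_cycle_trivial[OF comp _ i(1)] by blast
  then show False
    using dvd_div_eq_0_iff[OF xdvd[OF i(1)]] i(2) by blast
qed

text \<open>The point 1 with digit \<open>g - 1\<close> is fixed, as
  \<open>(1 + (g - 1)) / g = 1\<close>.\<close>

lemma not_complete_pred_base:
  assumes "g \<ge> 2"
  shows "\<not> complete_number g (g - 1)"
proof
  assume "complete_number g (g - 1)"
  moreover have "extreme_cycle g (g - 1) 1 (\<lambda>_. 1) (\<lambda>_. int (g - 1))"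
    using assms by (intro extreme_cycleI) (auto simp: of_nat_diff inj_on_def)
  ultimately have "(1::int) = 0"
    using complete_cycle_trivial[of g "g - 1" 1 "\<lambda>_. 1" _ 0] by simp
  then show False by simp
qed

theorem theorem4p8p1:
  fixes p g :: nat
  assumes "prime p" and "g = p + 1" and "even g" and "g \<ge> 4"
  shows "\<not> (\<exists>m. primitive_number g m \<and> m \<noteq> g - 1 \<and> ord m g < g)"
proof
  assume "\<exists>m. primitive_number g m \<and> m \<noteq> g - 1 \<and> ord m g < g"
  then obtain m where prim: "primitive_number g m" and ne: "m \<noteq> g - 1"
    and ord_lt: "ord m g < g" by blast
  have inc: "incomplete_number g m" using prim by (simp add: primitive_number_def)
  then have m: "m > 0" by (auto simp: incomplete_number_def intro: odd_pos)
  have g1: "int g - 1 = int p" using assms by simp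
  have pm: "\<not> p dvd m"
  proof
    assume "p dvd m"
    then have "complete_number g p"
      using prim ne assms(2) by (auto simp: primitive_number_def)
    then show False using not_complete_pred_base[of g] assms by simp
  qed
  obtain r x l i where cyc: "extreme_cycle g m r x l" and i: "i < r" "x i \<noteq> 0"
    by (rule incomplete_obtain_cycle[OF inc])
  have r: "r \<ge> 1" and l: "\<And>j. j < r \<Longrightarrow> l j \<in> {0, int m}"
    using cyc by (auto simp: extreme_cycle_def)
  have copr: "coprime m g" using primitive_number_coprime[OF prim] assms by simp
  have "r dvd ord m g"
    using extreme_cycle_length_dvd_ord[OF cyc _ m copr] assms by simp
  \<comment> \<open>Without coprimality \<open>ord\<close> would be 0, and divisibility would give
    no bound on \<open>r\<close>.\<close>
  moreover have "ord m g > 0" using copr by (simp add: ord_eq_0)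
  ultimately have rp: "r \<le> p" using ord_lt assms(2) by (auto dest: dvd_imp_le)
  have x0: "0 \<le> x j" and xle: "int p * x j \<le> int m" if "j < r" for j
    using extreme_cycle_bounds[OF cyc _ that] assms g1 by auto
  define k where "k = card {j \<in> {..<r}. l j \<noteq> 0}"
  have "(\<Sum>j<r. l j) = (\<Sum>j<r. if l j \<noteq> 0 then int m else 0)"
    using l by (intro sum.cong) auto
  also have "\<dots> = int m * int k"
    by (simp add: k_def sum.If_cases Collect_conj_eq lessThan_def)
  finally have sum: "int p * (\<Sum>j<r. x j) = int m * int k"
    using extreme_cycle_sum[OF cyc] assms g1 by simp
  then have "int p dvd int (m * k)" by (metis dvd_triv_left of_nat_mult)
  then have pk: "p dvd k"
    using pm assms(1) by (simp only: int_dvd_int_iff prime_dvd_mult_iff) auto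
  have "k \<le> r"
    using card_mono[of "{..<r}" "{j \<in> {..<r}. l j \<noteq> 0}"] by (auto simp: k_def)
  then consider "k = 0" | "k = p" "r = p"
    using pk rp by (metis dvd_imp_le le_antisym le_trans gr0I)
  then show False
  proof cases
    case 1
    then have "(\<Sum>j<r. x j) = 0" using sum assms by simp
    then have "\<forall>j\<in>{..<r}. x j = 0" using x0 by (subst (asm) sum_nonneg_eq_0_iff) auto
    with i show False by auto
  next
    case 2
    \<comment> \<open>With \<open>k = r = p\<close> the upper bounds \<open>p * x j \<le> m\<close>
      are attained on average, hence each of them is an equality.\<close>
    have "(\<Sum>j<r. int m - int p * x j) = 0"
      using sum 2 by (auto simp: sum_subtractf simp flip: sum_distrib_left)
    then have "\<forall>j\<in>{..<r}. int m - int p * x j = 0"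
      using xle by (subst (asm) sum_nonneg_eq_0_iff) auto
    then have "int m = int p * x 0" using r by auto
    then show False using pm by (metis dvd_triv_left int_dvd_int_iff)
  qed
qed

end
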